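(* Fix a positive integer $k$ and real numbers $\alpha,\beta\in(0,1)$ with $\alpha+\beta\geq1$. Let $\ell=\ell(n)\geq 2$ be an integer-valued function with $\ell=o(\sqrt{n})$. Then for all sufficiently large $n$ there is a cyclic ordering $S_0,S_1,\dots,S_{m-1}$ (indices mod $m$, $m=\binom nk$) of all $k$-element subsets of $[n]$ such that: (1) for every $i$, the $\ell$ consecutive sets $S_i,S_{i+1},\dots,S_{i+\ell-1}$ are pairwise disjoint, hence form a $(k,\ell)$-parpartition of $[n]$ (a consecutive-$(k,\ell)$-parpartition); and (2) any two consecutive-$(k,\ell)$-parpartitions $P_1=\{S_i,\dots,S_{i+\ell-1}\}$ and $P_2=\{S_j,\dots,S_{j+\ell-1}\}$ that share no set (i.e. the index windows are disjoint) are not $(\alpha,\beta)$-close.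
   Context: A $(k,\ell)$-parpartition of $[n]$ is a family of $\ell$ pairwise disjoint $k$-element subsets of $[n]$. Two parpartitions $P_1,P_2$ are $(\alpha,\beta)$-close if there exist sets $A_1\neq B_1$ in $P_1$ and $A_2\neq B_2$ in $P_2$ with $|A_1\cap A_2|>\alpha k$ and $|B_1\cap B_2|>\beta k$. *)

theory Defs
  imports Main "HOL-Library.Landau_Symbols"
begin

definition parpartition :: "nat \<Rightarrow> nat \<Rightarrow> nat \<Rightarrow> nat set set \<Rightarrow> bool" where
  "parpartition k l n P \<longleftrightarrow>
     P \<subseteq> {A. A \<subseteq> {1..n} \<and> card A = k} \<and> card P = l \<and>
     (\<forall>A\<in>P. \<forall>B\<in>P. A \<noteq> B \<longrightarrow> A \<inter> B = {})"

definition ab_close :: "real \<Rightarrow> real \<Rightarrow> nat \<Rightarrow> nat set set \<Rightarrow> nat set set \<Rightarrow> bool" where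
  "ab_close \<alpha> \<beta> k P1 P2 \<longleftrightarrow>
     (\<exists>A1\<in>P1. \<exists>B1\<in>P1. \<exists>A2\<in>P2. \<exists>B2\<in>P2. A1 \<noteq> B1 \<and> A2 \<noteq> B2 \<and>
        real (card (A1 \<inter> A2)) > \<alpha> * real k \<and> real (card (B1 \<inter> B2)) > \<beta> * real k)"

definition cwindow :: "nat \<Rightarrow> nat \<Rightarrow> nat \<Rightarrow> nat set" where
  "cwindow m l i = {(i + a) mod m | a. a < l}"

end

theory Submission
  imports Defs "HOL-Combinatorics.Permutations"
begin

text \<open>
  Start from an arbitrary arrangement of the \<open>k\<close>-sets and repair it by transpositions. Exchanging the
  set at a conflicting position \<open>p\<close> with the one at \<open>q\<close> creates no new conflict unless \<open>q\<close> can be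
  reached from \<open>p\<close> by a short walk whose steps are ``at cyclic distance less than \<open>\<ell>\<close>'' and ``large
  intersection''. With \<open>a > \<alpha>k\<close> and \<open>b > \<beta>k\<close> there are at most
  \<open>O(\<ell>\<^sup>2 n\<^bsup>k-a\<^esup> n\<^bsup>k-b\<^esup>) = O(\<ell>\<^sup>2 n\<^bsup>k-1\<^esup>)\<close> such \<open>q\<close>, which is fewer than the number of positions,
  so a good \<open>q\<close> exists and the number of conflicts can be decreased to zero. Intersecting sets at
  small distance are removed first, and close windows after that, because the count for the latter
  requires that nearby sets are already disjoint.
\<close>

section \<open>Repairing arrangements by transpositions\<close>

definition deg_le :: "'v set \<Rightarrow> ('v \<Rightarrow> 'v \<Rightarrow> bool) \<Rightarrow> nat \<Rightarrow> bool" where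
  "deg_le V P d \<longleftrightarrow> (\<forall>u\<in>V. card {v\<in>V. P u v} \<le> d)"

definition comp_on :: "'v set \<Rightarrow> ('v \<Rightarrow> 'v \<Rightarrow> bool) \<Rightarrow> ('v \<Rightarrow> 'v \<Rightarrow> bool) \<Rightarrow> 'v \<Rightarrow> 'v \<Rightarrow> bool" where
  "comp_on V P Q u w \<longleftrightarrow> (\<exists>v\<in>V. P u v \<and> Q v w)"

lemma deg_le_comp_on:
  assumes "finite V" "deg_le V P d" "deg_le V Q e"
  shows "deg_le V (comp_on V P Q) (d * e)"
  unfolding deg_le_def
proof
  fix u assume u: "u \<in> V"
  have "{w\<in>V. comp_on V P Q u w} = (\<Union>v\<in>{v\<in>V. P u v}. {w\<in>V. Q v w})"
    by (auto simp: comp_on_def)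
  also have "card \<dots> \<le> (\<Sum>v\<in>{v\<in>V. P u v}. card {w\<in>V. Q v w})"
    using assms(1) by (intro card_UN_le) auto
  also have "\<dots> \<le> (\<Sum>v\<in>{v\<in>V. P u v}. e)"
    using assms(3) by (intro sum_mono) (auto simp: deg_le_def)
  also have "\<dots> = card {v\<in>V. P u v} * e" by simp
  also have "\<dots> \<le> d * e"
    using assms(2) u by (intro mult_right_mono) (auto simp: deg_le_def)
  finally show "card {w\<in>V. comp_on V P Q u w} \<le> d * e" .
qed

text \<open>Degree bounds are proved once for \<open>k\<close>-sets. Pulled back along a bijection
  they hold for positions under every arrangement, so they survive all transpositions.\<close>

lemma deg_le_pullback:
  assumes "bij_betw S V F" "finite F" "deg_le F R d"
  shows "deg_le V (\<lambda>u v. R (S u) (S v)) d"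
  unfolding deg_le_def
proof
  fix u assume u: "u \<in> V"
  have "card {v\<in>V. R (S u) (S v)} \<le> card {B\<in>F. R (S u) B}"
    using assms(1,2) by (intro card_inj_on_le[of S])
      (auto simp: bij_betw_def intro: inj_on_subset)
  also have "\<dots> \<le> d"
    using assms(1,3) u by (auto simp: deg_le_def bij_betw_def)
  finally show "card {v\<in>V. R (S u) (S v)} \<le> d" .
qed

section \<open>Four-cycles and transpositions\<close>

text \<open>A pair of close disjoint windows, seen as a closed walk
  \<open>u1\<close>-\<open>v1\<close>-\<open>v2\<close>-\<open>u2\<close>-\<open>u1\<close> with
  steps \<open>D\<close>, \<open>B\<close>, \<open>D\<close>, \<open>A\<close>.\<close>

definition tangle ::
  "'v set \<Rightarrow> ('v \<Rightarrow> 'v \<Rightarrow> bool) \<Rightarrow> ('f \<Rightarrow> 'f \<Rightarrow> bool) \<Rightarrow> ('f \<Rightarrow> 'f \<Rightarrow> bool) \<Rightarrow> ('v \<Rightarrow> 'f)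
    \<Rightarrow> 'v \<Rightarrow> 'v \<Rightarrow> 'v \<Rightarrow> 'v \<Rightarrow> bool" where
  "tangle V D A B S u1 v1 u2 v2 \<longleftrightarrow>
     u1 \<in> V \<and> v1 \<in> V \<and> u2 \<in> V \<and> v2 \<in> V \<and> distinct [u1, v1, u2, v2] \<and>
     D u1 v1 \<and> D u2 v2 \<and> A (S u1) (S u2) \<and> B (S v1) (S v2)"

text \<open>After the exchange \<open>p\<close> holds \<open>S q\<close>, so a tangle through
  \<open>u1 = p\<close> opens up into a walk \<open>D\<close>, \<open>B\<close>, \<open>D\<close>,
  \<open>A\<close> from \<open>p\<close> to \<open>q\<close>; the case \<open>u1 = q\<close> gives
  \<open>A\<close>, \<open>D\<close>, \<open>B\<close>, \<open>D\<close>. Standing outside the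
  locale, the lemma can also be applied with \<open>A\<close> and \<open>B\<close>
  interchanged.\<close>

lemma tangle_swap_avoids:
  assumes D: "symp D" and A: "symp A" and AI: "\<And>x y. A x y \<Longrightarrow> I x y"
    and clash: "\<And>u v. u \<in> V \<Longrightarrow> v \<in> V \<Longrightarrow> D u v \<Longrightarrow> \<not> I (S u) (S v)"
    and pq: "p \<in> V" "q \<in> V" "p \<noteq> q" "\<not> D p q" "\<not> I (S p) (S q)"
    and B: "symp B"
    and walk1: "\<not> comp_on V (comp_on V (comp_on V D (\<lambda>u v. B (S u) (S v))) D) (\<lambda>u v. A (S u) (S v)) p q"
    and walk2: "\<not> comp_on V (comp_on V (comp_on V (\<lambda>u v. A (S u) (S v)) D) (\<lambda>u v. B (S u) (S v))) D p q"
    and T: "tangle V D A B (S \<circ> transpose p q) u1 v1 u2 v2"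
  shows "u1 \<noteq> p" "u1 \<noteq> q"
proof -
  have T': "u1 \<in> V" "v1 \<in> V" "u2 \<in> V" "v2 \<in> V" "distinct [u1, v1, u2, v2]" "D u1 v1" "D u2 v2"
    "A (S (transpose p q u1)) (S (transpose p q u2))" "B (S (transpose p q v1)) (S (transpose p q v2))"
    using T by (auto simp: tangle_def)
  have D': "D v2 u2" "D v1 u1" and qp: "\<not> D q p"
    using T' D pq by (auto dest: sympD)
  show "u1 \<noteq> p"
  proof
    assume u1: "u1 = p"
    have v1: "v1 \<noteq> q" "v1 \<noteq> p" using T' u1 pq by auto
    have "u2 \<noteq> q" using T' u1 AI pq A by (auto dest: sympD)
    then have u2: "A (S q) (S u2)" "A (S u2) (S q)" using T' u1 A by (auto dest: sympD)
    \<comment> \<open>Here clash-freeness is essential: \<open>u2\<close> is not moved, so with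
      \<open>v2 = q\<close> the near positions \<open>u2\<close> and \<open>q\<close> would hold
      intersecting sets already under \<open>S\<close>.\<close>
    have "v2 \<noteq> q" using clash[of u2 q] T' u2 AI pq by auto
    then have "B (S v1) (S v2)" using T' u1 v1 by auto
    then show False using walk1 T' D' u1 u2 by (auto simp: comp_on_def)
  qed
  show "u1 \<noteq> q"
  proof
    assume u1: "u1 = q"
    have v1: "v1 \<noteq> q" "v1 \<noteq> p" using T' u1 pq qp by auto
    have "u2 \<noteq> p" using T' u1 AI pq by auto
    then have u2: "A (S p) (S u2)" "A (S u2) (S p)" using T' u1 A by (auto dest: sympD)
    have "v2 \<noteq> p" using clash[of u2 p] T' u2 AI pq by auto
    then have "B (S v2) (S v1)" using T' u1 v1 B by (auto dest: sympD)
    then show False using walk2 T' D' u1 u2 by (auto simp: comp_on_def)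
  qed
qed

section \<open>Descent by good transpositions\<close>

text \<open>Intended reading: \<open>V\<close> positions, \<open>F\<close> the
  \<open>k\<close>-sets, \<open>D\<close> sharing a window, \<open>I\<close> intersecting,
  \<open>A\<close> and \<open>B\<close> intersecting above the two thresholds. The sum in
  \<open>few\<close> counts \<open>p\<close> itself, its neighbours under \<open>D\<close> and
  \<open>I\<close>, two kinds of walks of length two and four kinds of length four.\<close>

locale repair =
  fixes V :: "'v set" and F :: "'f set" and D :: "'v \<Rightarrow> 'v \<Rightarrow> bool"
    and I A B :: "'f \<Rightarrow> 'f \<Rightarrow> bool" and d e a b :: nat
  assumes finite_V: "finite V" and finite_F: "finite F"
    and symp_D: "symp D" and irreflp_D: "irreflp D"
    and symp_I: "symp I" and symp_A: "symp A" and symp_B: "symp B"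
    and A_imp_I: "A x y \<Longrightarrow> I x y" and B_imp_I: "B x y \<Longrightarrow> I x y"
    and deg_D: "deg_le V D d" and deg_I: "deg_le F I e"
    and deg_A: "deg_le F A a" and deg_B: "deg_le F B b"
    and few: "1 + d + e + 2 * d * e + 4 * d^2 * (a * b) < card V"
begin

definition clashes :: "('v \<Rightarrow> 'f) \<Rightarrow> ('v \<times> 'v) set" where
  "clashes S = {(u, v) \<in> V \<times> V. D u v \<and> I (S u) (S v)}"

definition tangles :: "('v \<Rightarrow> 'f) \<Rightarrow> ('v \<times> 'v \<times> 'v \<times> 'v) set" where
  "tangles S = {(u1, v1, u2, v2). tangle V D A B S u1 v1 u2 v2}"

lemma finite_clashes: "finite (clashes S)"
  by (rule finite_subset[of _ "V \<times> V"]) (auto simp: clashes_def finite_V)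

lemma finite_tangles: "finite (tangles S)"
  by (rule finite_subset[of _ "V \<times> V \<times> V \<times> V"]) (auto simp: tangles_def tangle_def finite_V)

lemma bij_betw_swap:
  assumes "bij_betw S V F" "p \<in> V" "q \<in> V"
  shows "bij_betw (S \<circ> transpose p q) V F"
  using assms by (intro bij_betw_trans[of _ V V]) (auto intro!: permutes_imp_bij permutes_swap_id)

text \<open>The walks of length two guard against new clashes. Those of length four guard against
  new tangles: one pair for \<open>u1\<close> and \<open>u2\<close>, the other, with
  \<open>A\<close> and \<open>B\<close> interchanged, for \<open>v1\<close> and
  \<open>v2\<close>.\<close>

definition walk_free :: "('v \<Rightarrow> 'f) \<Rightarrow> 'v \<Rightarrow> 'v \<Rightarrow> bool" where
  "walk_free S p q \<longleftrightarrow> (let I' = (\<lambda>u v. I (S u) (S v)); A' = (\<lambda>u v. A (S u) (S v));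
       B' = (\<lambda>u v. B (S u) (S v)) in
     p \<noteq> q \<and> \<not> D p q \<and> \<not> I' p q \<and> \<not> comp_on V D I' p q \<and> \<not> comp_on V I' D p q \<and>
     \<not> comp_on V (comp_on V (comp_on V D B') D) A' p q \<and>
     \<not> comp_on V (comp_on V (comp_on V A' D) B') D p q \<and>
     \<not> comp_on V (comp_on V (comp_on V D A') D) B' p q \<and>
     \<not> comp_on V (comp_on V (comp_on V B' D) A') D p q)"

lemma ex_walk_free:
  assumes S: "bij_betw S V F" and p: "p \<in> V"
  shows "\<exists>q\<in>V. walk_free S p q"
proof (rule ccontr)
  assume none: "\<not> ?thesis"
  let ?I = "\<lambda>u v. I (S u) (S v)" and ?A = "\<lambda>u v. A (S u) (S v)" and ?B = "\<lambda>u v. B (S u) (S v)"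
  let ?N = "\<lambda>P. {q\<in>V. P p q}"
  let ?W1 = "comp_on V D ?I" and ?W2 = "comp_on V ?I D"
    and ?W3 = "comp_on V (comp_on V (comp_on V D ?B) D) ?A"
    and ?W4 = "comp_on V (comp_on V (comp_on V ?A D) ?B) D"
    and ?W5 = "comp_on V (comp_on V (comp_on V D ?A) D) ?B"
    and ?W6 = "comp_on V (comp_on V (comp_on V ?B D) ?A) D"
  note pull = deg_le_pullback[OF S finite_F]
  note comp = deg_le_comp_on[OF finite_V]
  have dI: "deg_le V ?I e" and dA: "deg_le V ?A a" and dB: "deg_le V ?B b"
    using pull deg_I deg_A deg_B by blast+
  have "deg_le V ?W1 (d * e)" "deg_le V ?W2 (e * d)"
    "deg_le V ?W3 (d * b * d * a)" "deg_le V ?W4 (a * d * b * d)"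
    "deg_le V ?W5 (d * a * d * b)" "deg_le V ?W6 (b * d * a * d)"
    by (intro comp dI dA dB deg_D)+
  then have c: "card (?N ?W1) \<le> d * e" "card (?N ?W2) \<le> e * d"
    "card (?N ?W3) \<le> d * b * d * a" "card (?N ?W4) \<le> a * d * b * d"
    "card (?N ?W5) \<le> d * a * d * b" "card (?N ?W6) \<le> b * d * a * d"
    "card (?N D) \<le> d" "card (?N ?I) \<le> e"
    using p dI deg_D by (simp_all add: deg_le_def)
  \<comment> \<open>Without a good \<open>q\<close>, the failure sets of the conditions would cover
    all positions.\<close>
  have "V \<subseteq> {p} \<union> (?N D \<union> (?N ?I \<union> (?N ?W1 \<union> (?N ?W2 \<union> (?N ?W3 \<union> (?N ?W4 \<union> (?N ?W5 \<union> ?N ?W6)))))))"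
    using none by (auto simp: walk_free_def Let_def)
  then have "card V \<le> card ({p} \<union> (?N D \<union> (?N ?I \<union> (?N ?W1 \<union> (?N ?W2 \<union> (?N ?W3 \<union> (?N ?W4 \<union> (?N ?W5 \<union> ?N ?W6))))))))"
    by (intro card_mono) (auto simp: finite_V)
  also have "\<dots> \<le> 1 + (d + (e + (d * e + (e * d + (d * b * d * a + (a * d * b * d + (d * a * d * b + b * d * a * d)))))))"
    by (intro order.trans[OF card_Un_le] add_mono c) auto
  also have "\<dots> = 1 + d + e + 2 * d * e + 4 * d^2 * (a * b)"
    by (simp add: power2_eq_square algebra_simps)
  finally show False using few by simp
qed

text \<open>A clash at \<open>p\<close> with some \<open>v\<close> would give the walk
  \<open>D\<close>, \<open>I\<close> through \<open>v\<close> from \<open>p\<close> to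
  \<open>q\<close>, and one at \<open>q\<close> the walk \<open>I\<close>, \<open>D\<close>.
  Removing the pairs that start at \<open>p\<close> makes the inclusion strict when \<open>p\<close>
  was in a clash.\<close>

lemma clashes_swap:
  assumes "p \<in> V" "q \<in> V" "walk_free S p q"
  shows "clashes (S \<circ> transpose p q) \<subseteq> clashes S - {(u, v). u = p}"
proof -
  have w: "p \<noteq> q" "\<not> D p q" "\<not> D q p" "\<not> I (S p) (S q)" "\<not> D p p" "\<not> D q q"
    "\<And>v. v \<in> V \<Longrightarrow> D p v \<Longrightarrow> I (S v) (S q) \<Longrightarrow> False"
    "\<And>v. v \<in> V \<Longrightarrow> I (S p) (S v) \<Longrightarrow> D v q \<Longrightarrow> False"
    using assms symp_D irreflp_D
    by (auto simp: walk_free_def Let_def comp_on_def irreflp_def dest: sympD)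
  have *: False if "u \<in> V" "v \<in> V" "D u v" "I (S (transpose p q u)) (S (transpose p q v))" "u = p \<or> u = q" for u v
  proof -
    have v: "v \<noteq> p" "v \<noteq> q" using that w by auto
    show False
      using that(5)
    proof
      assume "u = p"
      then show False using that v w(7)[of v] symp_I by (auto dest: sympD)
    next
      assume "u = q"
      then show False using that v w(8)[of v] symp_D by (auto dest: sympD)
    qed
  qed
  show ?thesis
  proof clarify
    fix u v assume uv: "(u, v) \<in> clashes (S \<circ> transpose p q)"
    then have 1: "u \<in> V" "v \<in> V" "D u v" "I (S (transpose p q u)) (S (transpose p q v))"
      by (auto simp: clashes_def)
    \<comment> \<open>The claim above treats only the first component; reversing the pair gives the
      second.\<close>
    then have "D v u" "I (S (transpose p q v)) (S (transpose p q u))"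
      using symp_D symp_I by (auto dest: sympD)
    then have "u \<noteq> p" "u \<noteq> q" "v \<noteq> p" "v \<noteq> q"
      using *[of u v] *[of v u] 1 by auto
    then show "(u, v) \<in> clashes S - {(u, v). u = p}"
      using 1 by (auto simp: clashes_def)
  qed
qed

lemma tangles_swap:
  assumes "p \<in> V" "q \<in> V" "walk_free S p q" "clashes S = {}"
  shows "tangles (S \<circ> transpose p q) \<subseteq> tangles S - {(u1, v1, u2, v2). u1 = p}"
proof clarify
  fix u1 v1 u2 v2 assume "(u1, v1, u2, v2) \<in> tangles (S \<circ> transpose p q)"
  then have T1: "tangle V D A B (S \<circ> transpose p q) u1 v1 u2 v2"
    by (simp add: tangles_def)
  \<comment> \<open>Symmetries of the four-cycle bring each of its positions to the front; for
    \<open>v1\<close> and \<open>v2\<close> this interchanges \<open>A\<close> and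
    \<open>B\<close>.\<close>
  then have T2: "tangle V D A B (S \<circ> transpose p q) u2 v2 u1 v1"
    and T3: "tangle V D B A (S \<circ> transpose p q) v1 u1 v2 u2"
    and T4: "tangle V D B A (S \<circ> transpose p q) v2 u2 v1 u1"
    using symp_D symp_A symp_B by (auto simp: tangle_def dest: sympD)
  have clash: "\<not> I (S u) (S v)" if "u \<in> V" "v \<in> V" "D u v" for u v
    using assms(4) that by (auto simp: clashes_def)
  note w = assms(3)[unfolded walk_free_def Let_def]
  have a: "u \<noteq> p \<and> u \<noteq> q" if "tangle V D A B (S \<circ> transpose p q) u v u' v'" for u v u' v'
    using tangle_swap_avoids[of D A I V S p q B, OF symp_D symp_A A_imp_I clash assms(1,2)]
      w symp_B that by blast
  have b: "u \<noteq> p \<and> u \<noteq> q" if "tangle V D B A (S \<circ> transpose p q) u v u' v'" for u v u' v'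
    using tangle_swap_avoids[of D B I V S p q A, OF symp_D symp_B B_imp_I clash assms(1,2)]
      w symp_A that by blast
  show "(u1, v1, u2, v2) \<in> tangles S - {(u1, v1, u2, v2). u1 = p}"
    using a[OF T1] a[OF T2] b[OF T3] b[OF T4] T1 by (auto simp: tangles_def tangle_def)
qed

lemma ex_clash_free:
  assumes "bij_betw S V F"
  shows "\<exists>S'. bij_betw S' V F \<and> clashes S' = {}"
  using assms
proof (induction "card (clashes S)" arbitrary: S rule: less_induct)
  case less
  show ?case
  proof (cases "clashes S = {}")
    case False
    then obtain p v where pv: "(p, v) \<in> clashes S" by auto
    then have p: "p \<in> V" by (auto simp: clashes_def)
    obtain q where q: "q \<in> V" "walk_free S p q" using ex_walk_free less.prems p by blast
    have "clashes (S \<circ> transpose p q) \<subset> clashes S"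
      using clashes_swap[OF p q] pv by auto
    then have "card (clashes (S \<circ> transpose p q)) < card (clashes S)"
      by (intro psubset_card_mono finite_clashes)
    then show ?thesis using less.hyps bij_betw_swap less.prems p q by blast
  qed (use less.prems in blast)
qed

text \<open>The same descent, now on tangles; an arrangement without clashes stays so, because a
  good swap creates none.\<close>

lemma ex_tangle_free:
  assumes "bij_betw S V F" "clashes S = {}"
  shows "\<exists>S'. bij_betw S' V F \<and> clashes S' = {} \<and> tangles S' = {}"
  using assms
proof (induction "card (tangles S)" arbitrary: S rule: less_induct)
  case less
  show ?case
  proof (cases "tangles S = {}")
    case False
    then obtain p v1 u2 v2 where pv: "(p, v1, u2, v2) \<in> tangles S" by (auto simp: tangles_def)
    then have p: "p \<in> V" by (auto simp: tangles_def tangle_def)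
    obtain q where q: "q \<in> V" "walk_free S p q" using ex_walk_free less.prems p by blast
    have "tangles (S \<circ> transpose p q) \<subset> tangles S"
      using tangles_swap[OF p q less.prems(2)] pv by auto
    then have "card (tangles (S \<circ> transpose p q)) < card (tangles S)"
      by (intro psubset_card_mono finite_tangles)
    moreover have "clashes (S \<circ> transpose p q) = {}"
      using clashes_swap[OF p q] less.prems by auto
    ultimately show ?thesis using less.hyps bij_betw_swap less.prems p q by blast
  qed (use less.prems in blast)
qed

end

section \<open>Counting\<close>

text \<open>Such a \<open>B\<close> is the union of an \<open>a\<close>-subset of \<open>A\<close>
  and \<open>k - a\<close> further points of \<open>{1..n}\<close>, which leaves at most
  \<open>k choose a\<close> times \<open>n choose (k - a)\<close> choices.\<close>

lemma deg_le_large_intersection: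
  assumes "k \<le> n"
  shows "deg_le {A. A \<subseteq> {1..n} \<and> card A = k} (\<lambda>A B. a \<le> card (A \<inter> B)) (2^k * n^(k - a))"
  unfolding deg_le_def
proof (rule ballI)
  fix A :: "nat set" assume "A \<in> {A. A \<subseteq> {1..n} \<and> card A = k}"
  then have A: "A \<subseteq> {1..n}" "card A = k" by auto
  have finA: "finite A" using A(1) finite_subset by blast
  let ?X = "{T. T \<subseteq> A \<and> card T = a}" and ?Y = "{U. U \<subseteq> {1..n} \<and> card U = k - a}"
  have fin: "finite ?X" "finite ?Y" using finA by auto
  have "{B \<in> {A. A \<subseteq> {1..n} \<and> card A = k}. a \<le> card (A \<inter> B)} \<subseteq> (\<lambda>(T, U). T \<union> U) ` (?X \<times> ?Y)"
  proof (rule subsetI)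
    fix B assume "B \<in> {B \<in> {A. A \<subseteq> {1..n} \<and> card A = k}. a \<le> card (A \<inter> B)}"
    then have B: "B \<subseteq> {1..n}" "a \<le> card (A \<inter> B)" "card B = k" by auto
    obtain T where T: "T \<subseteq> A \<inter> B" "card T = a"
      using B(2) obtain_subset_with_card_n by metis
    have "card (B - T) = k - a"
      using T B finA finite_subset[of T A] by (subst card_Diff_subset) auto
    then show "B \<in> (\<lambda>(T, U). T \<union> U) ` (?X \<times> ?Y)"
      using T B by (intro image_eqI[of _ _ "(T, B - T)"]) auto
  qed
  then have "card {B \<in> {A. A \<subseteq> {1..n} \<and> card A = k}. a \<le> card (A \<inter> B)} \<le> card (?X \<times> ?Y)"
    using fin by (intro surj_card_le) auto
  also have "\<dots> = (k choose a) * (n choose (k - a))"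
    using finA A by (simp add: card_cartesian_product n_subsets)
  also have "\<dots> \<le> 2^k * n^(k - a)"
    using assms by (intro mult_mono binomial_le_pow2 binomial_le_pow) auto
  finally show "card {B \<in> {A. A \<subseteq> {1..n} \<and> card A = k}. a \<le> card (A \<inter> B)} \<le> 2^k * n^(k - a)" .
qed

section \<open>Cyclic windows and the size estimate\<close>

definition cnear :: "nat \<Rightarrow> nat \<Rightarrow> nat \<Rightarrow> nat \<Rightarrow> bool" where
  "cnear m l u v \<longleftrightarrow> u \<noteq> v \<and> (\<exists>i. u \<in> cwindow m l i \<and> v \<in> cwindow m l i)"

text \<open>A neighbour \<open>v\<close> is determined by \<open>u\<close> and the signed offset
  \<open>y - x\<close>, which lies strictly between \<open>-l\<close> and \<open>l\<close>; hence
  the detour through integers.\<close>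

lemma deg_le_cnear: "deg_le {..<m} (cnear m l) (2 * l)"
  unfolding deg_le_def
proof
  fix u
  let ?f = "\<lambda>t. nat ((int u + t) mod int m)"
  have "{v \<in> {..<m}. cnear m l u v} \<subseteq> ?f ` {- int l..<int l}"
  proof clarify
    fix v assume "cnear m l u v"
    then obtain i x y where *: "u = (i + x) mod m" "v = (i + y) mod m" "x < l" "y < l"
      by (auto simp: cnear_def cwindow_def)
    have "(int u + (int y - int x)) mod int m = (int (i + x) + (int y - int x)) mod int m"
      unfolding * zmod_int by (simp add: mod_simps)
    also have "\<dots> = int v" by (simp add: * zmod_int)
    finally have "v = ?f (int y - int x)" by simp
    then show "v \<in> ?f ` {- int l..<int l}" using * by (intro image_eqI) auto
  qed
  then have "card {v \<in> {..<m}. cnear m l u v} \<le> card {- int l..<int l}"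
    by (intro surj_card_le) auto
  then show "card {v \<in> {..<m}. cnear m l u v} \<le> 2 * l" by simp
qed

text \<open>The left side is the bound \<open>few\<close> for the degrees at hand. Since
  \<open>k + 1 \<le> a + b\<close>, the exponents \<open>k - a\<close> and \<open>k - b\<close> add
  up to at most \<open>k - 1\<close>, so every term is \<open>O(l^2 * n^(k-1))\<close>, while
  \<open>n choose k\<close> is at least \<open>(n/k)^k\<close>.\<close>

lemma walk_count_less_binomial:
  fixes k n l a b :: nat
  assumes "1 \<le> k" "k \<le> n" "1 \<le> l" "a \<le> k" "b \<le> k" "k + 1 \<le> a + b"
    and large: "25 * 4^k * k^k * l^2 \<le> n"
  shows "1 + 2 * l + 2^k * n^(k - 1) + 2 * (2 * l) * (2^k * n^(k - 1))
    + 4 * (2 * l)^2 * (2^k * n^(k - a) * (2^k * n^(k - b))) < n choose k"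
proof -
  define M where "M = n^(k - 1)"
  define X where "X = l^2 * 4^k * M"
  have M: "1 \<le> M" using assms by (simp add: M_def)
  have l: "l \<le> l^2" using assms(3) by (simp add: power2_eq_square)
  have p: "(2::nat)^k \<le> 4^k" by (intro power_mono) auto
  have "n^(k - a) * n^(k - b) = n^(k - a + (k - b))" by (simp add: power_add)
  also have "\<dots> \<le> M"
    unfolding M_def using assms by (intro power_increasing) auto
  finally have ab: "n^(k - a) * n^(k - b) \<le> M" .
  have 1: "1 \<le> X" using M assms(3) by (simp add: X_def)
  have 2: "l \<le> X"
    using mult_mono[OF l mult_mono[OF one_le_power[of "4::nat" k] M]] by (simp add: X_def mult.assoc)
  have 4: "l * (2^k * M) \<le> X"
    using mult_mono[OF l mult_mono[OF p order.refl[of M]]] by (simp add: X_def mult.assoc)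
  have 3: "2^k * M \<le> X"
    using 4 mult_right_mono[OF assms(3), of "2^k * M"] by linarith
  have "2^k * n^(k - a) * (2^k * n^(k - b)) = 4^k * (n^(k - a) * n^(k - b))"
    using power_mult_distrib[of "2::nat" 2 k] by simp
  also have "\<dots> \<le> 4^k * M" using ab by simp
  finally have 5: "l^2 * (2^k * n^(k - a) * (2^k * n^(k - b))) \<le> X"
    unfolding X_def mult.assoc[of "l^2" "4^k" M] by (rule mult_left_mono) simp
  \<comment> \<open>Each term is at most its coefficient times \<open>X\<close>; the coefficients
    add up to 1 + 2 + 1 + 4 + 16 = 24, and \<open>1 \<le> X\<close> makes 25 strict.\<close>
  have "1 + 2 * l + 2^k * M + 4 * (l * (2^k * M)) + 16 * (l^2 * (2^k * n^(k - a) * (2^k * n^(k - b)))) < 25 * X"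
    using 1 2 3 4 5 by linarith
  also have "25 * X \<le> n choose k"
  proof -
    have "k^k * (25 * X) = (25 * 4^k * k^k * l^2) * M" by (simp add: X_def)
    also have "\<dots> \<le> n * M" using large by (rule mult_right_mono) simp
    also have "\<dots> = n^k" using assms(1) by (simp add: M_def power_eq_if)
    also have "\<dots> \<le> k^k * (n choose k)"
    proof -
      have "(real n / real k)^k \<le> real (n choose k)"
        using binomial_ge_n_over_k_pow_k[of k n, where 'a = real] assms by simp
      then have "real n^k \<le> real k^k * real (n choose k)"
        using assms(1) by (simp add: power_divide field_simps)
      then show ?thesis by (metis of_nat_le_iff of_nat_mult of_nat_power)
    qed
    finally show ?thesis using assms(1) by simp
  qed
  finally show ?thesis by (simp add: M_def power_mult_distrib algebra_simps)
qed

lemma inj_on_mod_window: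
  fixes i l m :: nat
  assumes "l \<le> m"
  shows "inj_on (\<lambda>a. (i + a) mod m) {..<l}"
proof (rule inj_onI)
  fix a b assume *: "a \<in> {..<l}" "b \<in> {..<l}" "(i + a) mod m = (i + b) mod m"
  obtain x y where "i + a + m * x = i + b + m * y"
    using *(3) nat_mod_eq_iff by blast
  then have "a + m * x = b + m * y" by simp
  then have "a mod m = b mod m" using nat_mod_eq_iff by blast
  then show "a = b" using * assms by simp
qed

section \<open>The ordering for one large \<open>n\<close>\<close>

lemma ex_cyclic_ordering:
  fixes k n l :: nat and \<alpha> \<beta> :: real
  assumes k: "k > 0" and \<alpha>: "0 < \<alpha>" "\<alpha> < 1" and \<beta>: "0 < \<beta>" "\<beta> < 1" and sum: "\<alpha> + \<beta> \<ge> 1"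
    and l: "1 \<le> l" and kn: "k \<le> n" and large: "25 * 4^k * k^k * l^2 \<le> n"
  defines "m \<equiv> n choose k"
  shows "\<exists>S :: nat \<Rightarrow> nat set.
        bij_betw S {..<m} {A. A \<subseteq> {1..n} \<and> card A = k} \<and>
        (\<forall>i < m. \<forall>a < l. \<forall>b < l. a \<noteq> b \<longrightarrow> S ((i + a) mod m) \<inter> S ((i + b) mod m) = {}) \<and>
        (\<forall>i < m. parpartition k l n (S ` cwindow m l i)) \<and>
        (\<forall>i < m. \<forall>j < m. cwindow m l i \<inter> cwindow m l j = {} \<longrightarrow>
            \<not> ab_close \<alpha> \<beta> k (S ` cwindow m l i) (S ` cwindow m l j))"
proof -
  define F where "F = {A. A \<subseteq> {1..n} \<and> card A = k}"
  \<comment> \<open>The least integer exceeding \<alpha>\<open>k\<close>, so that the real threshold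
    becomes \<open>a \<le> card\<close>; likewise \<open>b\<close> for \<beta>.\<close>
  define a where "a = nat \<lfloor>\<alpha> * k\<rfloor> + 1"
  define b where "b = nat \<lfloor>\<beta> * k\<rfloor> + 1"
  define R where "R = (\<lambda>(c::nat) (A::nat set) B. c \<le> card (A \<inter> B))"
  have nonneg: "0 \<le> \<alpha> * k" "0 \<le> \<beta> * k" and lt: "\<alpha> * k < k" "\<beta> * k < k" using assms by auto
  have ab: "1 \<le> a" "1 \<le> b" "a \<le> k" "b \<le> k"
    using nonneg lt unfolding a_def b_def by (simp_all, linarith+)
  have "real k \<le> \<alpha> * k + \<beta> * k" using sum by (metis distrib_right mult_1 mult_right_mono of_nat_0_le_iff)
  \<comment> \<open>The assumption on \<alpha> + \<beta> enters here: strictness and integrality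
    yield the extra 1 in \<open>k + 1 \<le> a + b\<close>.\<close>
  then have "real k < real a + real b"
    using nonneg unfolding a_def b_def by simp linarith
  then have sum_ab: "k + 1 \<le> a + b" by linarith
  have R_a: "R a X Y" if "\<alpha> * k < card (X \<inter> Y)" for X Y
    using that nonneg unfolding R_def a_def by simp linarith
  have R_b: "R b X Y" if "\<beta> * k < card (X \<inter> Y)" for X Y
    using that nonneg unfolding R_def b_def by simp linarith
  have finF: "finite F" by (simp add: F_def)
  have cardF: "card F = m" by (simp add: F_def m_def n_subsets)
  have few: "1 + 2 * l + 2^k * n^(k - 1) + 2 * (2 * l) * (2^k * n^(k - 1))
    + 4 * (2 * l)^2 * (2^k * n^(k - a) * (2^k * n^(k - b))) < m"
    unfolding m_def using walk_count_less_binomial[of k n l a b] assms ab sum_ab by simp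
  have lm: "l \<le> m" using few by linarith
  interpret repair "{..<m}" F "cnear m l" "R 1" "R a" "R b" "2 * l" "2^k * n^(k - 1)"
    "2^k * n^(k - a)" "2^k * n^(k - b)"
  proof
    show "symp (R c)" for c by (auto simp: symp_def R_def Int_commute)
    show "deg_le F (R 1) (2^k * n^(k - 1))" "deg_le F (R a) (2^k * n^(k - a))" "deg_le F (R b) (2^k * n^(k - b))"
      unfolding F_def R_def by (rule deg_le_large_intersection[OF kn])+
  qed (use few finF deg_le_cnear ab in \<open>auto simp: cnear_def symp_def irreflp_def R_def Int_commute\<close>)
  obtain S0 where "bij_betw S0 {..<m} F"
    using ex_bij_betw_nat_finite[OF finF] cardF by (auto simp: atLeast0LessThan)
  then obtain S where S: "bij_betw S {..<m} F" "clashes S = {}" "tangles S = {}"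
    using ex_clash_free ex_tangle_free by meson
  have m: "0 < m" using lm l by simp
  have win: "cwindow m l i \<subseteq> {..<m}" for i using m by (auto simp: cwindow_def)
  have SF: "S u \<in> F" if "u < m" for u using S(1) that by (auto simp: bij_betw_def)
  have inj: "inj_on S {..<m}" using S(1) by (simp add: bij_betw_def)
  have disj: "S u \<inter> S v = {}" if "u \<in> cwindow m l i" "v \<in> cwindow m l i" "u \<noteq> v" for u v i
  proof -
    have uv: "u < m" "v < m" using that win by auto
    have "cnear m l u v" using that by (auto simp: cnear_def)
    then have "\<not> R 1 (S u) (S v)" using S(2) uv by (auto simp: clashes_def simp del: One_nat_def)
    \<comment> \<open>Finiteness is needed to conclude from cardinality 0 that the intersection is
      empty.\<close>
    moreover have "finite (S u)" using SF[OF uv(1)] finite_subset by (auto simp: F_def)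
    ultimately show ?thesis by (auto simp: R_def not_le)
  qed
  have card_win: "card (cwindow m l i) = l" for i
  proof -
    have "cwindow m l i = (\<lambda>a. (i + a) mod m) ` {..<l}" by (auto simp: cwindow_def)
    then show ?thesis using card_image[OF inj_on_mod_window[OF lm]] by simp
  qed
  have "S ((i + x) mod m) \<inter> S ((i + y) mod m) = {}" if "x < l" "y < l" "x \<noteq> y" for i x y
    using that inj_on_mod_window[OF lm, of i]
    by (intro disj[of _ i]) (auto simp: cwindow_def inj_on_def)
  moreover have "parpartition k l n (S ` cwindow m l i)" for i
    unfolding parpartition_def
  proof (intro conjI)
    show "S ` cwindow m l i \<subseteq> {A. A \<subseteq> {1..n} \<and> card A = k}" using SF win by (auto simp: F_def)
    show "card (S ` cwindow m l i) = l"
      using card_image[OF inj_on_subset[OF inj win]] card_win by simp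
    show "\<forall>A\<in>S ` cwindow m l i. \<forall>B\<in>S ` cwindow m l i. A \<noteq> B \<longrightarrow> A \<inter> B = {}"
      using disj by blast
  qed
  moreover have "\<not> ab_close \<alpha> \<beta> k (S ` cwindow m l i) (S ` cwindow m l j)"
    if ij: "cwindow m l i \<inter> cwindow m l j = {}" for i j
  proof
    assume "ab_close \<alpha> \<beta> k (S ` cwindow m l i) (S ` cwindow m l j)"
    then obtain u1 v1 u2 v2 where uv: "u1 \<in> cwindow m l i" "v1 \<in> cwindow m l i"
      "u2 \<in> cwindow m l j" "v2 \<in> cwindow m l j" "S u1 \<noteq> S v1" "S u2 \<noteq> S v2"
      "R a (S u1) (S u2)" "R b (S v1) (S v2)"
      unfolding ab_close_def using R_a R_b by blast
    \<comment> \<open>Positions in the same window differ because their sets do; positions in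
      different windows differ because the windows are disjoint.\<close>
    then have "tangle {..<m} (cnear m l) (R a) (R b) S u1 v1 u2 v2"
      using ij win unfolding tangle_def cnear_def by auto
    then show False using S(3) by (auto simp: tangles_def)
  qed
  ultimately show ?thesis using S(1) unfolding F_def by blast
qed

theorem theorem1p7:
  fixes k :: nat and \<alpha> \<beta> :: real and L :: "nat \<Rightarrow> nat"
  assumes "k > 0"
    and "0 < \<alpha>" "\<alpha> < 1" "0 < \<beta>" "\<beta> < 1" "\<alpha> + \<beta> \<ge> 1"
    and "\<forall>n. L n \<ge> 2"
    and "(\<lambda>n. real (L n)) \<in> o(\<lambda>n. sqrt (real n))"
  shows "\<forall>\<^sub>F n in sequentially.
     \<exists>S :: nat \<Rightarrow> nat set.
        bij_betw S {..<n choose k} {A. A \<subseteq> {1..n} \<and> card A = k} \<and>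
        (\<forall>i < n choose k. \<forall>a < L n. \<forall>b < L n. a \<noteq> b \<longrightarrow>
            S ((i + a) mod (n choose k)) \<inter> S ((i + b) mod (n choose k)) = {}) \<and>
        (\<forall>i < n choose k. parpartition k (L n) n (S ` cwindow (n choose k) (L n) i)) \<and>
        (\<forall>i < n choose k. \<forall>j < n choose k.
            cwindow (n choose k) (L n) i \<inter> cwindow (n choose k) (L n) j = {} \<longrightarrow>
            \<not> ab_close \<alpha> \<beta> k (S ` cwindow (n choose k) (L n) i) (S ` cwindow (n choose k) (L n) j))"
proof -
  define C where "C = 25 * 4^k * k^k"
  have C: "0 < C" using assms(1) by (simp add: C_def)
  \<comment> \<open>The constant \<open>1 / sqrt C\<close> is chosen so that squaring gives
    \<open>C * (L n)^2 \<le> n\<close>, the size condition of the fixed-\<open>n\<close>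
    lemma.\<close>
  have "\<forall>\<^sub>F n in sequentially. norm (real (L n)) \<le> 1 / sqrt (real C) * norm (sqrt (real n))"
    using C by (intro landau_o.smallD[OF assms(8)]) simp
  then have "\<forall>\<^sub>F n in sequentially. C * (L n)^2 \<le> n"
  proof eventually_elim
    case (elim n)
    then have "sqrt (real C) * real (L n) \<le> sqrt (real n)" using C by (simp add: field_simps)
    then have "(sqrt (real C) * real (L n))^2 \<le> sqrt (real n)^2" by (intro power_mono) auto
    then have "real (C * (L n)^2) \<le> real n" by (simp add: power_mult_distrib)
    then show ?case by linarith
  qed
  then show ?thesis
    using eventually_ge_at_top[of k]
  proof eventually_elim
    case (elim n)
    have "1 \<le> L n" using assms(7) by (meson le_trans one_le_numeral)
    then show ?case
      using ex_cyclic_ordering[OF assms(1-6), of "L n" n] elim by (simp add: C_def)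
  qed
qed

end
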